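(* Let $X$ be a pre-Riesz space and $(Y,i)$ a vector lattice cover of $X$. Let $S\subseteq X_+$ be a non-empty subset. Then the smallest extension ideal in $Y$ of the ideal $\mathcal{I}_S$ of $X$ generated by $S$ is the ideal $\mathcal{I}_{i(S)}$ of $Y$ generated by $i(S)$.
   Context: All ordered vector spaces are real vector spaces with a partial order given by a cone $X_+$ ($x\le y$ iff $y-x\in X_+$). A linear subspace $D$ of an ordered vector space $Z$ is order dense in $Z$ if for every $z\in Z$ one has $z=\inf\{d\in D: z\le d\}$ (infimum in $Z$). A linear map $i$ is bipositive if $i(x)\ge 0\iff x\ge 0$. An ordered vector space $X$ is pre-Riesz if there are a vector lattice $Y$ and a bipositive linear map $i\colon X\to Y$ with $i(X)$ order dense in $Y$; then $(Y,i)$ is called a vector lattice cover of $X$. For $M\subseteq X$ let $M^u$ be the set of upper bounds of $M$ in $X$. A set $M\subseteq X$ is solid if $x\in X$, $y\in M$ and $\{x,-x\}^u\supseteq\{y,-y\}^u$ imply $x\in M$. An ideal is a solid linear subspace (in a vector lattice this is the usual notion). For a subset $M$ of an ordered vector space, $\mathcal{I}_M$ denotes the intersection of all ideals containing $M$ (the ideal generated by $M$). An ideal $J$ of $Y$ is an extension ideal of an ideal $I$ of $X$ if $I=\{x\in X: i(x)\in J\}$. If $I$ has an extension ideal, the intersection of all extension ideals of $I$ in $Y$ is again an extension ideal, the smallest extension ideal of $I$ in $Y$. *)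

theory Defs
  imports Complex_Main "HOL-Library.Lub_Glb" "HOL-Library.Lattice_Algebras"
begin

text \<open>
  Ordered vector spaces are types of class \<^class>\<open>ordered_real_vector\<close>. The suprema and infima
  of a vector lattice are those of \<^class>\<open>lattice\<close>.
\<close>

class vector_lattice = ordered_real_vector + lattice_ab_group_add

definition positive_cone :: "'a::ordered_real_vector set"
  where "positive_cone = {x. 0 \<le> x}"

definition order_dense :: "'a::ordered_real_vector set \<Rightarrow> bool"
  where "order_dense D \<longleftrightarrow> subspace D \<and> (\<forall>z. isGlb UNIV {d \<in> D. z \<le> d} z)"

definition bipositive :: "('a::ordered_real_vector \<Rightarrow> 'b::ordered_real_vector) \<Rightarrow> bool"
  where "bipositive i \<longleftrightarrow> (\<forall>x. 0 \<le> i x \<longleftrightarrow> 0 \<le> x)"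

text \<open>
  An ordered vector space \<open>'a\<close> is pre-Riesz if such a map \<open>i\<close> exists for some vector lattice
  \<open>'b\<close>. HOL cannot quantify existentially over \<open>'b\<close>, so \<open>'a\<close> being pre-Riesz is expressed by
  assuming a vector lattice cover of it.
\<close>

definition vector_lattice_cover :: "('a::ordered_real_vector \<Rightarrow> 'b::vector_lattice) \<Rightarrow> bool"
  where "vector_lattice_cover i \<longleftrightarrow> linear i \<and> bipositive i \<and> order_dense (range i)"

definition solid :: "'a::ordered_real_vector set \<Rightarrow> bool"
  where "solid M \<longleftrightarrow> (\<forall>x. \<forall>y\<in>M. ubs UNIV {y, - y} \<subseteq> ubs UNIV {x, - x} \<longrightarrow> x \<in> M)"

definition ideal :: "'a::ordered_real_vector set \<Rightarrow> bool"
  where "ideal I \<longleftrightarrow> subspace I \<and> solid I"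

definition ideal_generated :: "'a::ordered_real_vector set \<Rightarrow> 'a set"
  where "ideal_generated M = \<Inter>{I. ideal I \<and> M \<subseteq> I}"

definition extension_ideal ::
    "('a::ordered_real_vector \<Rightarrow> 'b::vector_lattice) \<Rightarrow> 'a set \<Rightarrow> 'b set \<Rightarrow> bool"
  where "extension_ideal i I J \<longleftrightarrow> ideal I \<and> ideal J \<and> I = {x. i x \<in> J}"

text \<open>
  Meaningful only if \<open>I\<close> has an extension ideal: otherwise the intersection is \<^term>\<open>UNIV\<close>.
\<close>

definition smallest_extension_ideal ::
    "('a::ordered_real_vector \<Rightarrow> 'b::vector_lattice) \<Rightarrow> 'a set \<Rightarrow> 'b set"
  where "smallest_extension_ideal i I = \<Inter>{J. extension_ideal i I J}"

end

theory Submission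
  imports Defs
begin

text \<open>
  Order density makes the preimage under \<open>i\<close> of every ideal of \<open>Y\<close> an ideal of \<open>X\<close>. Conversely, the
  elements of \<open>Y\<close> dominated in modulus by \<open>i s\<close> for some positive \<open>s\<close> in an ideal \<open>I\<close> of \<open>X\<close> form an
  ideal of \<open>Y\<close> with preimage contained in \<open>I\<close>. For \<open>I = \<I>\<^sub>S\<close> with \<open>S\<close> positive, this ideal contains
  \<open>i(S)\<close>, so the preimage of \<open>\<I>\<^bsub>i(S)\<^esub>\<close> is exactly \<open>\<I>\<^sub>S\<close>.
\<close>

lemma ubs_abs_iff: "u \<in> ubs UNIV {x, - x} \<longleftrightarrow> x \<le> u \<and> - x \<le> u"
  by (auto simp: ubs_def isUb_def setle_def)

lemma solidD:
  assumes "solid M" "y \<in> M" "\<And>u. y \<le> u \<Longrightarrow> - y \<le> u \<Longrightarrow> x \<le> u \<and> - x \<le> u"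
  shows "x \<in> M"
proof -
  have "ubs UNIV {y, - y} \<subseteq> ubs UNIV {x, - x}"
    using assms(3) by (auto simp: ubs_abs_iff)
  with assms(1,2) show ?thesis
    unfolding solid_def by blast
qed

text \<open>By transitivity, every upper bound of \<open>s\<close> also bounds \<open>x\<close> and
  \<open>- x\<close>, which is the inclusion that solidity asks for. No lattice operations enter, so
  this applies in \<open>X\<close> itself.\<close>

lemma ideal_dominated:
  assumes "ideal I" "s \<in> I" "x \<le> s" "- x \<le> s"
  shows "x \<in> I"
proof (rule solidD)
  show "solid I" using assms(1) by (simp add: ideal_def)
  show "x \<le> u \<and> - x \<le> u" if "s \<le> u" for u
    using that assms(3,4) by (blast intro: order_trans)
qed (fact assms(2))

lemma ideal_Inter:
  assumes "\<And>I. I \<in> F \<Longrightarrow> ideal I"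
  shows "ideal (\<Inter>F)"
  using assms unfolding ideal_def solid_def subspace_def by blast

lemma ideal_ideal_generated: "ideal (ideal_generated M)"
  unfolding ideal_generated_def by (rule ideal_Inter) auto

lemma subset_ideal_generated: "M \<subseteq> ideal_generated M"
  unfolding ideal_generated_def by blast

lemma ideal_generated_least: "ideal I \<Longrightarrow> M \<subseteq> I \<Longrightarrow> ideal_generated M \<subseteq> I"
  unfolding ideal_generated_def by blast

lemma bipositive_le_iff:
  assumes "linear i" "bipositive i"
  shows "i x \<le> i y \<longleftrightarrow> x \<le> y"
proof -
  have "0 \<le> i (y - x) \<longleftrightarrow> 0 \<le> y - x"
    using assms(2) by (auto simp: bipositive_def)
  then show ?thesis by (simp add: linear_diff[OF assms(1)])
qed

lemma ideal_preimage:
  fixes i :: "'a::ordered_real_vector \<Rightarrow> 'b::vector_lattice"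
  assumes "vector_lattice_cover i" "ideal J"
  shows "ideal {x. i x \<in> J}"
proof -
  have lin: "linear i" and bip: "bipositive i" and dense: "order_dense (range i)"
    using assms(1) by (auto simp: vector_lattice_cover_def)
  note le = bipositive_le_iff[OF lin bip] and neg = linear_neg[OF lin]
  have J: "subspace J" "solid J" using assms(2) by (auto simp: ideal_def)
  have "subspace {x. i x \<in> J}"
    using J(1) by (simp add: subspace_def linear_0[OF lin] linear_add[OF lin] linear_cmul[OF lin])
  moreover have "solid {x. i x \<in> J}"
    unfolding solid_def
  proof (intro allI ballI impI, simp only: mem_Collect_eq)
    fix x y
    assume y: "i y \<in> J" and sub: "ubs UNIV {y, - y} \<subseteq> ubs UNIV {x, - x}"
    \<comment> \<open>This is the modulus of \<open>i y\<close>. The \<open>d\<close> with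
      \<open>w \<le> i d\<close> are upper bounds of \<open>y\<close> and \<open>- y\<close> in
      \<open>X\<close>, where the hypothesis \<open>sub\<close> can be applied.\<close>
    define w where "w = sup (i y) (- i y)"
    have bound: "i x \<le> i d \<and> - i x \<le> i d" if "w \<le> i d" for d
    proof -
      have "i y \<le> i d" "i (- y) \<le> i d"
        using that by (auto simp: w_def neg)
      then have "d \<in> ubs UNIV {y, - y}" by (simp add: le ubs_abs_iff)
      with sub have "x \<le> d \<and> - x \<le> d" using ubs_abs_iff by blast
      then show ?thesis by (simp add: le flip: neg)
    qed
    \<comment> \<open>Order density enters here: \<open>w\<close> is the infimum of the elements of
      \<open>range i\<close> above it. By \<open>bound\<close>, \<open>i x\<close> and
      \<open>- i x\<close> are lower bounds of these elements, hence lie below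
      \<open>w\<close>.\<close>
    have glb: "isGlb UNIV {d \<in> range i. w \<le> d} w"
      using dense by (auto simp: order_dense_def)
    have "i x \<le> w" "- i x \<le> w"
      by (rule isGlb_le_isLb[OF glb], use bound in \<open>auto simp: isLb_def setge_def\<close>)+
    \<comment> \<open>Every upper bound of \<open>i y\<close> and \<open>- i y\<close> lies above
      their supremum \<open>w\<close>, hence above \<open>i x\<close> and
      \<open>- i x\<close>.\<close>
    then show "i x \<in> J"
      by (intro solidD[OF J(2) y]) (auto simp: w_def intro: order_trans)
  qed
  ultimately show ?thesis by (simp add: ideal_def)
qed

lemma ideal_dominated_by_image:
  fixes i :: "'a::ordered_real_vector \<Rightarrow> 'b::ordered_real_vector"
  assumes lin: "linear i" and "subspace I"
  shows "ideal {y. \<exists>s\<in>I. 0 \<le> s \<and> y \<le> i s \<and> - y \<le> i s}" (is "ideal ?K")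
proof -
  have I: "0 \<in> I" "\<And>s t. s \<in> I \<Longrightarrow> t \<in> I \<Longrightarrow> s + t \<in> I" "\<And>c s. s \<in> I \<Longrightarrow> c *\<^sub>R s \<in> I"
    using assms(2) by (auto simp: subspace_def)
  have "subspace ?K"
    unfolding subspace_def
  proof (intro conjI ballI allI)
    show "0 \<in> ?K" using I(1) linear_0[OF lin] by auto
  next
    fix x y assume "x \<in> ?K" "y \<in> ?K"
    then obtain s t where s: "s \<in> I" "0 \<le> s" "x \<le> i s" "- x \<le> i s"
      and t: "t \<in> I" "0 \<le> t" "y \<le> i t" "- y \<le> i t" by blast
    have "x + y \<le> i (s + t)" "- (x + y) \<le> i (s + t)"
      using add_mono[OF s(3) t(3)] add_mono[OF s(4) t(4)]
      by (simp_all add: linear_add[OF lin] add.commute)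
    moreover have "0 \<le> s + t" using s(2) t(2) by simp
  ultimately show "x + y \<in> ?K" using I(2)[OF s(1) t(1)] by blast
  next
    fix c :: real and x assume "x \<in> ?K"
    then obtain s where s: "s \<in> I" "0 \<le> s" "x \<le> i s" "- x \<le> i s" by blast
    \<comment> \<open>For negative \<open>c\<close> the two inequalities for \<open>x\<close> trade
      places.\<close>
    have "c *\<^sub>R x \<le> i (\<bar>c\<bar> *\<^sub>R s) \<and> - (c *\<^sub>R x) \<le> i (\<bar>c\<bar> *\<^sub>R s)"
      using scaleR_left_mono[OF s(3), of "\<bar>c\<bar>"] scaleR_left_mono[OF s(4), of "\<bar>c\<bar>"]
      by (cases "0 \<le> c") (simp_all add: linear_cmul[OF lin] linear_neg[OF lin])
    moreover have "0 \<le> \<bar>c\<bar> *\<^sub>R s" using s(2) by (simp add: scaleR_nonneg_nonneg)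
    ultimately show "c *\<^sub>R x \<in> ?K" using I(3)[OF s(1)] by blast
  qed
  \<comment> \<open>The witness \<open>s\<close> is kept: \<open>i s\<close> is an upper bound of
    \<open>y\<close> and \<open>- y\<close>, hence of every pair \<open>x\<close>,
    \<open>- x\<close> whose upper bounds include those of \<open>y\<close> and
    \<open>- y\<close>.\<close>
  moreover have "solid ?K"
    unfolding solid_def subset_iff ubs_abs_iff by blast
  ultimately show ?thesis by (simp add: ideal_def)
qed

theorem proposition15:
  fixes i :: "'a::ordered_real_vector \<Rightarrow> 'b::vector_lattice" and S :: "'a set"
  assumes "vector_lattice_cover i"
    and "S \<subseteq> positive_cone"
    and "S \<noteq> {}"
  shows "extension_ideal i (ideal_generated S) (ideal_generated (i ` S)) \<and>
    smallest_extension_ideal i (ideal_generated S) = ideal_generated (i ` S)"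
proof -
  let ?I = "ideal_generated S" and ?J = "ideal_generated (i ` S)"
  let ?K = "{y. \<exists>s\<in>?I. 0 \<le> s \<and> y \<le> i s \<and> - y \<le> i s}"
  have lin: "linear i" and bip: "bipositive i"
    using assms(1) by (auto simp: vector_lattice_cover_def)
  note le = bipositive_le_iff[OF lin bip]
  have "S \<subseteq> {x. i x \<in> ?J}"
    using subset_ideal_generated[of "i ` S"] by blast
  then have "?I \<subseteq> {x. i x \<in> ?J}"
    by (intro ideal_generated_least ideal_preimage assms(1) ideal_ideal_generated)
  moreover have "{x. i x \<in> ?J} \<subseteq> ?I"
  proof -
    \<comment> \<open>The witness is \<open>s\<close> itself. Positivity of \<open>S\<close> gives
      \<open>- s \<le> 0 \<le> s\<close>, so \<open>i s\<close> dominates both \<open>i s\<close>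
      and \<open>- i s\<close>.\<close>
    have "i s \<in> ?K" if "s \<in> S" for s
    proof -
      have "0 \<le> s" using that assms(2) by (auto simp: positive_cone_def)
      moreover have "- s \<le> s" using \<open>0 \<le> s\<close> order_trans[of "- s" 0 s] by simp
      then have "- i s \<le> i s" by (simp add: le flip: linear_neg[OF lin])
      moreover have "s \<in> ?I" using that subset_ideal_generated by blast
      ultimately show ?thesis by blast
    qed
    moreover have "ideal ?K"
      using ideal_dominated_by_image[OF lin] ideal_ideal_generated by (auto simp: ideal_def)
    ultimately have "?J \<subseteq> ?K" by (intro ideal_generated_least) auto
    \<comment> \<open>Bipositivity carries the domination of \<open>i x\<close> by
      \<open>i s\<close> back to \<open>X\<close>, where \<open>?I\<close> is solid.\<close>
    moreover have "x \<in> ?I" if x: "i x \<in> ?K" for x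
    proof -
      obtain s where s: "s \<in> ?I" "i x \<le> i s" "- i x \<le> i s" using x by blast
      have "x \<le> s" using s(2) by (simp add: le)
      moreover have "- x \<le> s" using s(3) by (simp add: le flip: linear_neg[OF lin])
      ultimately show ?thesis
        by (rule ideal_dominated[OF ideal_ideal_generated s(1)])
    qed
    ultimately show ?thesis by blast
  qed
  ultimately have ext: "extension_ideal i ?I ?J"
    unfolding extension_ideal_def by (intro conjI equalityI ideal_ideal_generated)
  have "?J \<subseteq> J" if "extension_ideal i ?I J" for J
  proof -
    have "ideal J" "?I = {x. i x \<in> J}" using that by (auto simp: extension_ideal_def)
    then show ?thesis
      using subset_ideal_generated[of S] by (intro ideal_generated_least) auto
  qed
  with ext show ?thesis
    unfolding smallest_extension_ideal_def by blast
qed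

end
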